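(* Let $p,q\in\mathbb{R}[x]$ be polynomials such that $\mathscr{W}(p)$ and $\mathscr{W}(q)$ are symmetric and $\operatorname{defect}(p)=\operatorname{defect}(q)$. Then $\mathscr{W}(pq)$ is symmetric and $\operatorname{defect}(pq)=\operatorname{defect}(p)=\operatorname{defect}(q)$. Furthermore, if $\mathscr{W}(p)$ and $\mathscr{W}(q)$ are $\gamma$-positive, then $\mathscr{W}(pq)$ is $\gamma$-positive.
   Context: For a polynomial $p\in\mathbb{R}[x]$ of degree $d$, $\mathscr{W}(p)$ denotes the polynomial of degree at most $d$ defined by $\sum_{j\ge0}p(j)x^j=\mathscr{W}(p)(x)/(1-x)^{d+1}$. For a polynomial $a$ of degree at most $s$, let $\mathcal{I}_s(a)(x)=x^s a(1/x)$; $a$ is symmetric with center of symmetry $s/2$ if $\mathcal{I}_s(a)=a$. We say $\mathscr{W}(p)$ is symmetric if $\mathcal{I}_s\mathscr{W}(p)=\mathscr{W}(p)$ for some $s\le \deg p$, and then the defect of $p$ is $\operatorname{defect}(p)=\deg p - s$. A polynomial $a$ symmetric with center $s/2$ can be uniquely written as $a(x)=\sum_{i=0}^{\lfloor s/2\rfloor}\gamma_i x^i(1+x)^{s-2i}$; it is $\gamma$-positive if all $\gamma_i\ge 0$. *)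

theory Defs
  imports Complex_Main "HOL-Computational_Algebra.Computational_Algebra"
begin

definition W :: "real poly \<Rightarrow> real poly" where
  "W p = (THE w. degree w \<le> degree p \<and>
     Abs_fps (\<lambda>j. poly p (of_nat j)) = fps_of_poly w / (1 - fps_X) ^ (degree p + 1))"

(* x^s a(1/x) = x^(s - deg a) * (x^(deg a) a(1/x)); only meaningful for degree a \<le> s *)
definition reversal :: "nat \<Rightarrow> real poly \<Rightarrow> real poly" where
  "reversal s a = monom 1 (s - degree a) * reflect_poly a"

definition symmetric_center :: "nat \<Rightarrow> real poly \<Rightarrow> bool" where
  "symmetric_center s a \<longleftrightarrow> degree a \<le> s \<and> reversal s a = a"

definition W_symmetric :: "real poly \<Rightarrow> bool" where
  "W_symmetric p \<longleftrightarrow> (\<exists>s\<le>degree p. symmetric_center s (W p))"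

definition defect :: "real poly \<Rightarrow> nat" where
  "defect p = degree p - (THE s. s \<le> degree p \<and> symmetric_center s (W p))"

(* s is determined by a unless a = 0, and then the coefficients are determined by a;
   see symmetric_center_unique and gamma_expansion_unique below *)
definition gamma_positive :: "real poly \<Rightarrow> bool" where
  "gamma_positive a \<longleftrightarrow> (\<exists>s \<gamma>. symmetric_center s a \<and>
     a = (\<Sum>i\<le>s div 2. smult (\<gamma> i) (monom 1 i * [:1, 1:] ^ (s - 2 * i))) \<and>
     (\<forall>i\<le>s div 2. \<gamma> i \<ge> 0))"

text \<open>The objects picked by the definite descriptions above exist and are unique.\<close>

lemma degree_shift_diff:
  fixes p :: "real poly"
  assumes "degree p \<le> Suc d"
  shows "degree (pcompose p [:1, 1:] - p) \<le> d"
proof (rule degree_le, intro allI impI)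
  fix i assume i: "i > d"
  have deg: "degree (pcompose p [:1, 1:]) = degree p"
    by (simp add: degree_pcompose)
  show "coeff (pcompose p [:1, 1:] - p) i = 0"
  proof (cases "i = degree p")
    case True
    then show ?thesis
      using lead_coeff_comp[of "[:1, 1:]" p] deg by simp
  next
    case False
    then have "i > degree p" using i assms by simp
    then show ?thesis using deg by (simp add: coeff_eq_0)
  qed
qed

lemma W_exists_aux:
  fixes p :: "real poly"
  assumes "degree p \<le> d"
  shows "\<exists>w. degree w \<le> d \<and>
    Abs_fps (\<lambda>j. poly p (of_nat j)) * (1 - fps_X) ^ Suc d = fps_of_poly w"
  using assms
proof (induction d arbitrary: p)
  case 0
  then obtain c where c: "p = [:c:]" by (metis degree_eq_zeroE le_zero_eq)
  have "Abs_fps (\<lambda>j. poly p (of_nat j)) * (1 - fps_X) = fps_of_poly [:c:]"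
    by (rule fps_ext) (auto simp: c algebra_simps fps_of_poly_const)
  then show ?case by (intro exI[of _ "[:c:]"]) simp
next
  case (Suc d)
  let ?q = "pcompose p [:1, 1:] - p"
  obtain w where w: "degree w \<le> d"
    "Abs_fps (\<lambda>j. poly ?q (of_nat j)) * (1 - fps_X) ^ Suc d = fps_of_poly w"
    using Suc.IH[OF degree_shift_diff[OF Suc.prems]] by blast
  have step: "Abs_fps (\<lambda>j. poly p (of_nat j)) * (1 - fps_X) =
      fps_const (poly p 0) + fps_X * Abs_fps (\<lambda>j. poly ?q (of_nat j))"
  proof (rule fps_ext)
    fix n
    show "(Abs_fps (\<lambda>j. poly p (of_nat j)) * (1 - fps_X)) $ n =
      (fps_const (poly p 0) + fps_X * Abs_fps (\<lambda>j. poly ?q (of_nat j))) $ n"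
      by (cases n) (auto simp: algebra_simps poly_pcompose)
  qed
  define v where "v = smult (poly p 0) ([:1, -1:] ^ Suc d) + pCons 0 w"
  have lin: "fps_of_poly [:1, -1:] = (1 - fps_X :: real fps)"
    by (rule fps_ext) (auto simp: coeff_pCons split: nat.splits)
  have "Abs_fps (\<lambda>j. poly p (of_nat j)) * (1 - fps_X) ^ Suc (Suc d) =
      (Abs_fps (\<lambda>j. poly p (of_nat j)) * (1 - fps_X)) * (1 - fps_X) ^ Suc d"
    by (simp add: mult.assoc)
  also have "\<dots> = fps_const (poly p 0) * (1 - fps_X) ^ Suc d + fps_X *
      (Abs_fps (\<lambda>j. poly ?q (of_nat j)) * (1 - fps_X) ^ Suc d)"
    unfolding step by (simp only: distrib_right mult.assoc)
  also have "\<dots> = fps_const (poly p 0) * (1 - fps_X) ^ Suc d + fps_X * fps_of_poly w"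
    by (simp only: w(2))
  also have "\<dots> = fps_of_poly v"
    unfolding v_def fps_of_poly_add fps_of_poly_smult fps_of_poly_power lin fps_of_poly_pCons
    by (simp add: mult.commute)
  finally have "Abs_fps (\<lambda>j. poly p (of_nat j)) * (1 - fps_X) ^ Suc (Suc d) = fps_of_poly v" .
  moreover have "degree v \<le> Suc d"
  proof -
    have "degree ([:1, -1:] ^ Suc d :: real poly) \<le> Suc d"
      using degree_power_le[of "[:1, -1:] :: real poly" "Suc d"] by simp
    moreover have "degree (pCons 0 w) \<le> Suc d"
      using w(1) degree_pCons_le[of 0 w] by linarith
    ultimately show ?thesis
      unfolding v_def by (meson degree_add_le degree_smult_le order_trans)
  qed
  ultimately show ?case by blast
qed

lemma W_exists_unique:
  "\<exists>!w. degree w \<le> degree p \<and>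
    Abs_fps (\<lambda>j. poly p (of_nat j)) = fps_of_poly w / (1 - fps_X :: real fps) ^ (degree p + 1)"
proof -
  have "(1 - fps_X :: real fps) $ 0 \<noteq> 0" by simp
  then have unit: "((1 - fps_X :: real fps) ^ (degree p + 1)) $ 0 \<noteq> 0"
    by simp
  then have nz: "(1 - fps_X :: real fps) ^ (degree p + 1) \<noteq> 0"
    by (metis fps_zero_nth)
  have eq: "A = B / (1 - fps_X) ^ (degree p + 1) \<longleftrightarrow>
      A * (1 - fps_X) ^ (degree p + 1) = B" for A B :: "real fps"
  proof -
    have "(1 - fps_X) ^ (degree p + 1) dvd B"
      using unit by (meson fps_is_unit_iff unit_imp_dvd)
    then show ?thesis using nz by auto
  qed
  show ?thesis unfolding eq
    using W_exists_aux[of p "degree p"] by (metis Suc_eq_plus1 fps_of_poly_eq_iff order_refl)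
qed

lemma W_spec:
  "degree (W p) \<le> degree p"
  "Abs_fps (\<lambda>j. poly p (of_nat j)) = fps_of_poly (W p) / (1 - fps_X) ^ (degree p + 1)"
  using theI'[OF W_exists_unique[of p]] unfolding W_def by blast+

lemma poly_reversal:
  assumes "degree a \<le> s" "x \<noteq> 0"
  shows "poly (reversal s a) x = x ^ s * poly a (1 / x)"
  using assms unfolding reversal_def
  by (simp add: poly_monom poly_reflect_poly_nz inverse_eq_divide flip: power_add mult.assoc)

lemma symmetric_center_unique:
  assumes "a \<noteq> 0" "symmetric_center s a" "symmetric_center t a"
  shows "s = t"
proof -
  have "degree (reversal u a) = u - degree a + degree (reflect_poly a)" for u
    using assms(1) unfolding reversal_def by (simp add: degree_mult_eq degree_monom_eq)
  then show ?thesis using assms(2,3) unfolding symmetric_center_def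
    by (metis add_right_cancel le_add_diff_inverse)
qed

lemma W_nonzero:
  assumes "p \<noteq> 0"
  shows "W p \<noteq> 0"
proof
  assume "W p = 0"
  then have "Abs_fps (\<lambda>j. poly p (of_nat j)) = 0"
    using W_spec(2)[of p] by simp
  then have "poly p (of_nat j) = 0" for j
    by (metis fps_nth_Abs_fps fps_zero_nth)
  then have "range real \<subseteq> {x. poly p x = 0}" by auto
  then show False
    using poly_roots_finite[OF assms] finite_subset range_inj_infinite inj_of_nat by blast
qed

lemma defect_center_unique:
  assumes "W_symmetric p"
  shows "\<exists>!s. s \<le> degree p \<and> symmetric_center s (W p)"
proof (cases "p = 0")
  case True
  then show ?thesis using assms unfolding W_symmetric_def by auto
next
  case False
  then show ?thesis using assms symmetric_center_unique[OF W_nonzero]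
    unfolding W_symmetric_def by blast
qed

lemma gamma_expansion_unique:
  fixes \<gamma> \<delta> :: "nat \<Rightarrow> real"
  assumes eq: "(\<Sum>i\<le>m. smult (\<gamma> i) (monom 1 i * [:1, 1:] ^ (s - 2 * i))) =
    (\<Sum>i\<le>m. smult (\<delta> i) (monom 1 i * [:1, 1:] ^ (s - 2 * i)))"
  shows "n \<le> m \<Longrightarrow> \<gamma> n = \<delta> n"
proof (induction n rule: less_induct)
  case (less n)
  let ?b = "\<lambda>i. coeff (monom 1 i * [:1, 1:] ^ (s - 2 * i) :: real poly) n"
  have "(\<Sum>i\<le>m. (\<gamma> i - \<delta> i) * ?b i) = 0"
    using arg_cong[OF eq, of "\<lambda>f. coeff f n"]
    by (simp add: coeff_sum sum_subtractf left_diff_distrib)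
  moreover have "(\<Sum>i\<le>m. (\<gamma> i - \<delta> i) * ?b i) = (\<Sum>i\<in>{n}. (\<gamma> i - \<delta> i) * ?b i)"
  proof (rule sum.mono_neutral_right)
    show "\<forall>i\<in>{..m} - {n}. (\<gamma> i - \<delta> i) * ?b i = 0"
    proof
      fix i assume "i \<in> {..m} - {n}"
      then consider "i < n" "i \<le> m" | "i > n" by force
      then show "(\<gamma> i - \<delta> i) * ?b i = 0"
        by cases (use less.IH in \<open>auto simp: coeff_monom_mult\<close>)
    qed
  qed (use less.prems in auto)
  moreover have "?b n = 1"
    by (simp add: coeff_monom_mult coeff_0_power)
  ultimately show ?case by simp
qed

end

theory Submission imports Defs begin

text \<open>Write \<open>p = \<Sum>\<^sub>k c\<^sub>k (x choose k)\<close> and \<open>E p = \<Sum>\<^sub>k c\<^sub>k x\<^sup>k\<close>. Then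
  \<open>E p (x) = (1 + x)\<^sup>d W p (x / (1 + x))\<close> with \<open>d = deg p\<close>, and \<open>E (p q) (x)\<close> is the constant
  term in \<open>t\<close> of \<open>E p (x + t) E q (x + y / t)\<close>, where \<open>y = x (1 + x)\<close>. Put \<open>u = 1 + 2 x\<close>. If \<open>W p\<close>
  is symmetric with center \<open>s / 2\<close> and the defect is \<open>r\<close>, the gamma basis element
  \<open>x\<^sup>i (1 + x)\<^sup>m\<close>, \<open>m = s - 2 i\<close>, becomes \<open>(1 + x)\<^sup>r y\<^sup>i u\<^sup>m\<close>. Under
  \<open>x \<rightarrow> x + t\<close> and \<open>x \<rightarrow> x + y / t\<close> the factors \<open>y\<close>, \<open>u\<close> become
  \<open>y + u t + t\<^sup>2\<close>, \<open>u + 2 t\<close> and \<open>y (y + u t + t\<^sup>2) / t\<^sup>2\<close>, \<open>u + 2 y / t\<close>, while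
  \<open>(1 + x + t) (1 + x + y / t) = (1 + x) (u + t + y / t)\<close>. Everything is homogeneous with
  nonnegative coefficients for the weights 1, 1, 2 of \<open>t\<close>, \<open>u\<close>, \<open>y\<close>, so the constant term is
  \<open>(1 + x)\<^sup>r\<close> times a nonnegative combination of \<open>y\<^sup>i u\<^sup>m\<close> of weight \<open>s + s' + r\<close>.
  The same computation with arbitrary real coefficients gives the symmetry and the defect,
  since every symmetric polynomial has a gamma expansion.\<close>

text \<open>Substitutions such as \<open>x / (1 + x)\<close> or \<open>1 / x\<close> are undefined
  at one point; since a nonzero polynomial has finitely many roots, that point may be left
  out.\<close>

lemma poly_eqI_except:
  fixes f g :: "real poly"
  assumes "\<And>x. x \<noteq> c \<Longrightarrow> poly f x = poly g x"
  shows "f = g"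
proof (rule ccontr)
  assume "f \<noteq> g"
  then have "finite {x. poly (f - g) x = 0}" by (intro poly_roots_finite) simp
  moreover have "- {c} \<subseteq> {x. poly (f - g) x = 0}" using assms by auto
  ultimately have "finite (- {c})" by (rule rev_finite_subset)
  then have "finite (UNIV :: real set)" by (metis finite_compl finite.emptyI finite_insert)
  then show False using infinite_UNIV_char_0 by blast
qed

section \<open>Coefficients in the binomial basis and their relation to \<open>W\<close>\<close>

definition binom_eval :: "nat \<Rightarrow> real poly \<Rightarrow> real" where
  "binom_eval n f = (\<Sum>k\<le>n. coeff f k * real (n choose k))"

text \<open>\<open>n choose k\<close> vanishes for \<open>k > n\<close> and \<open>coeff f k\<close>
  beyond the degree, so the cutoff \<open>n\<close>, which depends on the point, can be traded for
  any degree bound.\<close>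

lemma binom_eval_eq_sum:
  assumes "degree f \<le> d"
  shows "binom_eval n f = (\<Sum>k\<le>d. coeff f k * real (n choose k))"
proof -
  have "binom_eval n f = (\<Sum>k\<le>max n d. coeff f k * real (n choose k))"
    unfolding binom_eval_def by (rule sum.mono_neutral_left) (auto simp: binomial_eq_0)
  also have "\<dots> = (\<Sum>k\<le>d. coeff f k * real (n choose k))"
    by (rule sum.mono_neutral_right) (use assms in \<open>auto simp: coeff_eq_0\<close>)
  finally show ?thesis .
qed

lemma binom_eval_sum: "binom_eval n (\<Sum>i\<in>A. f i) = (\<Sum>i\<in>A. binom_eval n (f i))"
  unfolding binom_eval_def by (simp add: coeff_sum sum_distrib_right) (rule sum.swap)

lemma binom_eval_smult: "binom_eval n (smult c f) = c * binom_eval n f"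
  unfolding binom_eval_def by (simp add: sum_distrib_left mult.assoc)

lemma fps_binomial_column:
  "Abs_fps (\<lambda>n. of_nat (n choose k)) * (1 - fps_X) ^ Suc k = (fps_X ^ k :: real fps)"
proof (induction k)
  case 0
  show ?case by (rule fps_ext) (auto simp: algebra_simps)
next
  case (Suc k)
  \<comment> \<open>Pascal's rule: a factor \<open>1 - fps_X\<close> moves down one column and
    leaves a factor \<open>fps_X\<close>.\<close>
  have "Abs_fps (\<lambda>n. of_nat (n choose Suc k)) * (1 - fps_X) =
      fps_X * (Abs_fps (\<lambda>n. of_nat (n choose k)) :: real fps)" (is "?l = ?r")
  proof (rule fps_ext)
    fix n show "?l $ n = ?r $ n" by (cases n) (auto simp: algebra_simps)
  qed
  then have "Abs_fps (\<lambda>n. of_nat (n choose Suc k)) * (1 - fps_X) ^ Suc (Suc k) =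
      fps_X * (Abs_fps (\<lambda>n. of_nat (n choose k)) * (1 - fps_X :: real fps) ^ Suc k)"
    unfolding power_Suc[of _ "Suc k"] by (simp only: flip: mult.assoc)
  then show ?case unfolding Suc.IH by simp
qed

text \<open>Sends \<open>W p\<close>, with \<open>d = degree p\<close>, to the polynomial whose coefficients are those of \<open>p\<close> in
  the basis \<open>x choose k\<close>.\<close>

definition binom_transform :: "nat \<Rightarrow> real poly \<Rightarrow> real poly" where
  "binom_transform d V = (\<Sum>i\<le>d. smult (coeff V i) (monom 1 i * [:1, 1:] ^ (d - i)))"

lemma poly_eq_sum:
  fixes f :: "real poly"
  assumes "degree f \<le> d"
  shows "poly f x = (\<Sum>i\<le>d. coeff f i * x ^ i)"
proof -
  have "poly f x = poly (\<Sum>i\<le>d. monom (coeff f i) i) x"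
    using poly_as_sum_of_monoms'[OF assms] by simp
  then show ?thesis by (simp add: poly_sum poly_monom)
qed

lemma poly_homogenized:
  fixes f :: "real poly"
  assumes "degree f \<le> d" "b \<noteq> 0"
  shows "(\<Sum>i\<le>d. coeff f i * (a ^ i * b ^ (d - i))) = b ^ d * poly f (a / b)"
  unfolding poly_eq_sum[OF assms(1)] sum_distrib_left
  by (intro sum.cong refl) (use assms(2) in \<open>auto simp: power_divide power_diff field_simps\<close>)

lemma poly_binom_transform:
  assumes "degree V \<le> d" "x \<noteq> -1"
  shows "poly (binom_transform d V) x = (1 + x) ^ d * poly V (x / (1 + x))"
  using poly_homogenized[OF assms(1), of "1 + x" x] assms(2)
  by (simp add: binom_transform_def poly_sum poly_monom)

lemma degree_binom_transform_le: "degree (binom_transform d V) \<le> d"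
  unfolding binom_transform_def
proof (intro degree_sum_le finite_atMost order_trans[OF degree_smult_le])
  fix i assume "i \<in> {..d}"
  then show "degree (monom 1 i * [:1, 1:] ^ (d - i) :: real poly) \<le> d"
    by (intro order_trans[OF degree_mult_le])
      (simp add: degree_monom_eq degree_power_eq)
qed

text \<open>The substitutions \<open>z / (1 - z)\<close> and \<open>x / (1 + x)\<close> are inverse
  to each other, and \<open>1 + z / (1 - z) = 1 / (1 - z)\<close> makes the homogenizing factors
  cancel.\<close>

lemma binom_transform_inverse:
  assumes "degree V \<le> d"
  shows "(\<Sum>k\<le>d. smult (coeff (binom_transform d V) k) (monom 1 k * [:1, -1:] ^ (d - k))) = V"
proof (rule poly_eqI_except[of 1])
  fix z :: real assume z: "z \<noteq> 1"
  have "z / (1 - z) \<noteq> -1" using z by (simp add: field_simps)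
  moreover have "1 + z / (1 - z) = 1 / (1 - z)" using z by (simp add: field_simps)
  ultimately have "(1 - z) ^ d * poly (binom_transform d V) (z / (1 - z)) = poly V z"
    using z by (simp add: poly_binom_transform[OF assms] power_divide)
  then show "poly (\<Sum>k\<le>d. smult (coeff (binom_transform d V) k)
      (monom 1 k * [:1, -1:] ^ (d - k))) z = poly V z"
    using poly_homogenized[OF degree_binom_transform_le, of "1 - z" d V z] z
    by (simp add: poly_sum poly_monom)
qed

text \<open>\<open>fps_binomial_column\<close> turns the summand for \<open>k\<close> into a
  multiple of \<open>fps_X ^ k * (1 - fps_X) ^ (d - k)\<close>, and these add up to the inverse
  transform.\<close>

lemma fps_binom_eval_transform:
  assumes "degree V \<le> d"
  shows "Abs_fps (\<lambda>n. binom_eval n (binom_transform d V)) * (1 - fps_X) ^ Suc d = fps_of_poly V"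
proof -
  let ?f = "binom_transform d V"
  have lin: "fps_of_poly [:1, -1:] = (1 - fps_X :: real fps)"
    by (simp add: fps_of_poly_linear' flip: fps_const_neg)
  have "Abs_fps (\<lambda>n. binom_eval n ?f) =
      (\<Sum>k\<le>d. fps_const (coeff ?f k) * Abs_fps (\<lambda>n. of_nat (n choose k)))"
    by (rule fps_ext)
      (simp add: fps_sum_nth binom_eval_eq_sum[OF degree_binom_transform_le])
  then have "Abs_fps (\<lambda>n. binom_eval n ?f) * (1 - fps_X) ^ Suc d =
      (\<Sum>k\<le>d. fps_const (coeff ?f k) * (Abs_fps (\<lambda>n. of_nat (n choose k)) * (1 - fps_X) ^ Suc d))"
    by (simp add: sum_distrib_right mult.assoc)
  also have "\<dots> = (\<Sum>k\<le>d. fps_const (coeff ?f k) * (fps_X ^ k * (1 - fps_X) ^ (d - k)))"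
  proof (intro sum.cong refl)
    fix k assume "k \<in> {..d}"
    then have "(1 - fps_X :: real fps) ^ Suc d = (1 - fps_X) ^ Suc k * (1 - fps_X) ^ (d - k)"
      by (simp flip: power_add power_Suc)
    then have "Abs_fps (\<lambda>n. of_nat (n choose k)) * (1 - fps_X) ^ Suc d =
        Abs_fps (\<lambda>n. of_nat (n choose k)) * (1 - fps_X :: real fps) ^ Suc k * (1 - fps_X) ^ (d - k)"
      by (simp only: mult.assoc)
    then show "fps_const (coeff ?f k) * (Abs_fps (\<lambda>n. of_nat (n choose k)) * (1 - fps_X) ^ Suc d)
        = fps_const (coeff ?f k) * (fps_X ^ k * (1 - fps_X) ^ (d - k))"
      by (simp only: fps_binomial_column)
  qed
  also have "\<dots> = fps_of_poly
      (\<Sum>k\<le>d. smult (coeff ?f k) (monom 1 k * [:1, -1:] ^ (d - k)))"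
    unfolding fps_of_poly_sum fps_of_poly_smult fps_of_poly_mult fps_of_poly_power lin
      fps_of_poly_monom' ..
  finally show ?thesis unfolding binom_transform_inverse[OF assms] .
qed

lemma fps_eq_divide_iff:
  "A = B / (1 - fps_X) ^ n \<longleftrightarrow> A * (1 - fps_X) ^ n = B" for A B :: "real fps"
proof -
  have u: "((1 - fps_X :: real fps) ^ n) $ 0 \<noteq> 0" by simp
  then have "(1 - fps_X) ^ n dvd B" "(1 - fps_X :: real fps) ^ n \<noteq> 0"
    by (meson fps_is_unit_iff unit_imp_dvd) (use u in \<open>metis fps_zero_nth\<close>)
  then show ?thesis by auto
qed

lemma poly_eq_binom_eval_W:
  "poly p (real n) = binom_eval n (binom_transform (degree p) (W p))"
proof -
  have "Abs_fps (\<lambda>n. binom_eval n (binom_transform (degree p) (W p))) =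
      Abs_fps (\<lambda>j. poly p (of_nat j))"
    using fps_binom_eval_transform[OF W_spec(1)[of p]] W_spec(2)[of p]
    unfolding Suc_eq_plus1 by (metis fps_eq_divide_iff)
  from arg_cong[OF this, of "\<lambda>F. F $ n"] show ?thesis by simp
qed

text \<open>Removes power series from the rest of the proof: \<open>W\<close> of a product is found
  by matching values at natural numbers.\<close>

lemma W_eqI:
  assumes "degree V \<le> degree p"
    and "\<And>n. poly p (real n) = binom_eval n (binom_transform (degree p) V)"
  shows "W p = V"
proof -
  have "Abs_fps (\<lambda>j. poly p (of_nat j)) = fps_of_poly V / (1 - fps_X) ^ (degree p + 1)"
    using fps_binom_eval_transform[OF assms(1)]
    unfolding fps_eq_divide_iff assms(2) Suc_eq_plus1 .
  then show ?thesis using W_exists_unique[of p] W_spec[of p] assms(1) by blast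
qed

section \<open>Products of binomial coefficients and the diamond product\<close>

lemma sum_choose_mult_choose:
  "(\<Sum>k\<le>a. (a choose k) * (b choose k) * (k choose i)) = (a choose i) * ((a + b - i) choose a)"
proof (cases "i \<le> a")
  case False
  then show ?thesis by (auto simp: binomial_eq_0 intro!: sum.neutral)
next
  case True
  \<comment> \<open>Trinomial revision takes out \<open>a choose i\<close>; once
    \<open>k - i\<close> is reflected to \<open>a - k\<close>, a Vandermonde sum remains.\<close>
  have "(\<Sum>k\<le>a. (a choose k) * (b choose k) * (k choose i)) =
      (\<Sum>k\<le>a. (a choose i) * ((b choose k) * ((a - i) choose (a - k))))"
  proof (intro sum.cong refl)
    fix k assume k: "k \<in> {..a}"
    show "(a choose k) * (b choose k) * (k choose i) =
        (a choose i) * ((b choose k) * ((a - i) choose (a - k)))"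
    proof (cases "i \<le> k")
      case True
      have "(a choose k) * (k choose i) = (a choose i) * ((a - i) choose (k - i))"
        using choose_mult[OF True] k by simp
      moreover have "(a - i) choose (k - i) = (a - i) choose (a - k)"
        using binomial_symmetric[of "k - i" "a - i"] True k by simp
      ultimately show ?thesis by (metis mult.assoc mult.commute)
    next
      case False
      then show ?thesis using k \<open>i \<le> a\<close> by (simp add: binomial_eq_0)
    qed
  qed
  also have "\<dots> = (a choose i) * ((b + (a - i)) choose a)"
    by (simp add: vandermonde flip: sum_distrib_left)
  finally show ?thesis using True by (simp add: add.commute)
qed

text \<open>By Vandermonde the inner sum is \<open>(n + k) choose (a + b)\<close>; expanded, it is
  \<open>binom_eval n\<close> of \<open>x^(a+b-k) (1+x)^k\<close>. Summing over \<open>k\<close>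
  first uses \<open>sum_choose_mult_choose\<close>; the sum over \<open>i\<close> is then another
  Vandermonde sum.\<close>

lemma choose_times_choose:
  "(n choose a) * (n choose b) =
   (\<Sum>k\<le>a. (a choose k) * (b choose k) * (\<Sum>i\<le>a + b. (k choose i) * (n choose (a + b - i))))"
proof -
  have "(\<Sum>k\<le>a. (a choose k) * (b choose k) * (\<Sum>i\<le>a + b. (k choose i) * (n choose (a + b - i))))
    = (\<Sum>i\<le>a + b. (n choose (a + b - i)) *
        (\<Sum>k\<le>a. (a choose k) * (b choose k) * (k choose i)))"
    unfolding sum_distrib_left by (subst sum.swap) (simp add: ac_simps)
  also have "\<dots> = (\<Sum>i\<le>a + b. (a choose i) *
      ((n choose (a + b - i)) * ((a + b - i) choose a)))"
    unfolding sum_choose_mult_choose by (simp add: ac_simps)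
  \<comment> \<open>For \<open>i > b\<close> the factor \<open>(a + b - i) choose a\<close> is
    zero.\<close>
  also have "\<dots> = (\<Sum>i\<le>b. (a choose i) *
      ((n choose (a + b - i)) * ((a + b - i) choose a)))"
    by (rule sum.mono_neutral_right) (auto simp: binomial_eq_0)
  also have "\<dots> = (\<Sum>i\<le>b. (a choose i) * ((n choose a) * ((n - a) choose (b - i))))"
  proof (rule sum.cong[OF refl])
    fix i assume i: "i \<in> {..b}"
    have "(n choose (a + b - i)) * ((a + b - i) choose a) = (n choose a) * ((n - a) choose (b - i))"
    proof (cases "a + b - i \<le> n")
      case True
      then show ?thesis using choose_mult[of a "a + b - i" n] i by simp
    next
      case False
      then show ?thesis using i by (cases "a \<le> n") (auto simp: binomial_eq_0)
    qed
    then show "(a choose i) * ((n choose (a + b - i)) * ((a + b - i) choose a)) =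
        (a choose i) * ((n choose a) * ((n - a) choose (b - i)))" by simp
  qed
  also have "\<dots> = (n choose a) * (\<Sum>i\<le>b. (a choose i) * ((n - a) choose (b - i)))"
    by (simp add: sum_distrib_left ac_simps)
  also have "\<dots> = (n choose a) * (n choose b)"
    by (cases "a \<le> n") (simp_all add: vandermonde binomial_eq_0)
  finally show ?thesis by simp
qed

text \<open>By \<open>choose_times_choose\<close> this holds the coefficients, in the basis
  \<open>x choose k\<close>, of the product of \<open>x choose a\<close> and
  \<open>x choose b\<close>.\<close>

definition diamond_monom :: "nat \<Rightarrow> nat \<Rightarrow> real poly" where
  "diamond_monom a b = (\<Sum>k\<le>a. smult (real ((a choose k) * (b choose k)))
     (monom 1 (a + b - k) * [:1, 1:] ^ k))"

lemma binom_eval_monom_linear_power: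
  assumes "k \<le> m"
  shows "binom_eval n (monom 1 (m - k) * [:1, 1:] ^ k) =
    real (\<Sum>i\<le>m. (k choose i) * (n choose (m - i)))"
proof -
  have c: "coeff (monom 1 (m - k) * [:1, 1:] ^ k :: real poly) (m - i) = real (k choose i)"
    if "i \<le> m" for i
  proof (cases "i \<le> k")
    case True
    then have "m - i - (m - k) = k - i" using assms that by simp
    then show ?thesis using True assms that
      by (simp add: coeff_monom_mult coeff_linear_poly_power binomial_symmetric[of i k])
  next
    case False
    then show ?thesis using that by (simp add: coeff_monom_mult binomial_eq_0)
  qed
  have "degree (monom 1 (m - k) * [:1, 1:] ^ k :: real poly) \<le> m"
    using assms by (intro order_trans[OF degree_mult_le])
      (simp add: degree_monom_eq degree_power_eq)
  then have "binom_eval n (monom 1 (m - k) * [:1, 1:] ^ k) =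
      (\<Sum>i\<le>m. coeff (monom 1 (m - k) * [:1, 1:] ^ k) i * real (n choose i))"
    by (rule binom_eval_eq_sum)
  also have "\<dots> = (\<Sum>i\<le>m. coeff (monom 1 (m - k) * [:1, 1:] ^ k) (m - i) * real (n choose (m - i)))"
    by (rule sum.nat_diff_reindex[symmetric, of _ "Suc m", simplified lessThan_Suc_atMost, simplified])
  finally show ?thesis by (simp add: c)
qed

lemma binom_eval_diamond_monom:
  "binom_eval n (diamond_monom a b) = real (n choose a) * real (n choose b)"
proof -
  have "binom_eval n (diamond_monom a b) = (\<Sum>k\<le>a. real ((a choose k) * (b choose k)) *
      real (\<Sum>i\<le>a + b. (k choose i) * (n choose (a + b - i))))"
    unfolding diamond_monom_def binom_eval_sum binom_eval_smult
    by (intro sum.cong refl) (simp only: binom_eval_monom_linear_power trans_le_add1 atMost_iff)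
  also have "\<dots> = real ((n choose a) * (n choose b))"
    by (simp add: choose_times_choose[of n a b])
  finally show ?thesis by simp
qed

text \<open>Wagner's diamond product \<open>\<Sum>\<^sub>k f\<^sup>(\<^sup>k\<^sup>) g\<^sup>(\<^sup>k\<^sup>) x\<^sup>k (1 + x)\<^sup>k / k!\<^sup>2\<close>: the multiplication of
  coefficient polynomials in the basis \<open>x choose k\<close>.\<close>

definition diamond :: "real poly \<Rightarrow> real poly \<Rightarrow> real poly" where
  "diamond f g = (\<Sum>a\<le>degree f. \<Sum>b\<le>degree g. smult (coeff f a * coeff g b) (diamond_monom a b))"

lemma binom_eval_diamond: "binom_eval n (diamond f g) = binom_eval n f * binom_eval n g"
  unfolding diamond_def binom_eval_sum binom_eval_smult binom_eval_diamond_monom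
    binom_eval_eq_sum[OF order_refl, of n f] binom_eval_eq_sum[OF order_refl, of n g]
    sum_product
  by (simp add: ac_simps)

lemma coeff_linear_poly_power':
  fixes a b :: real
  shows "coeff ([:a, b:] ^ n) i = of_nat (n choose i) * b ^ i * a ^ (n - i)"
proof (cases "i \<le> n")
  case True
  then show ?thesis by (rule coeff_linear_poly_power)
next
  case False
  have "degree ([:a, b:] ^ n) \<le> n"
    using degree_power_le[of "[:a, b:]" n] degree_pCons_le[of a "[:b:]"]
    by (auto intro: order_trans split: if_splits)
  then show ?thesis using False by (simp add: coeff_eq_0 binomial_eq_0)
qed

lemma coeff_pcompose_linear:
  fixes f :: "real poly"
  shows "coeff (pcompose f [:x, c:]) k =
    (\<Sum>a\<le>degree f. coeff f a * (real (a choose k) * c ^ k * x ^ (a - k)))"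
proof -
  have "pcompose f [:x, c:] = (\<Sum>a\<le>degree f. smult (coeff f a) ([:x, c:] ^ a))"
    by (simp add: pcompose_altdef poly_altdef degree_map_poly coeff_map_poly)
  then show ?thesis by (simp add: coeff_sum coeff_linear_poly_power')
qed

text \<open>Splitting \<open>x^(a+b-k) (1+x)^k\<close> into \<open>x^(a-k)\<close>,
  \<open>(x (1+x))^k\<close> and \<open>x^(b-k)\<close> displays the coefficients of
  \<open>t^k\<close> in \<open>(x + t)^a\<close> and in \<open>(x + x (1+x) t)^b\<close>.\<close>

lemma poly_diamond_monom:
  assumes "b \<le> N"
  shows "poly (diamond_monom a b) x = (\<Sum>k\<le>N. (real (a choose k) * x ^ (a - k)) *
    (real (b choose k) * (x * (1 + x)) ^ k * x ^ (b - k)))"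
proof -
  let ?t = "\<lambda>k. (real (a choose k) * x ^ (a - k)) *
    (real (b choose k) * (x * (1 + x)) ^ k * x ^ (b - k))"
  have "poly (diamond_monom a b) x = (\<Sum>k\<le>a. ?t k)"
    unfolding diamond_monom_def poly_sum
  proof (intro sum.cong refl)
    fix k assume k: "k \<in> {..a}"
    show "poly (smult (real ((a choose k) * (b choose k))) (monom 1 (a + b - k) * [:1, 1:] ^ k)) x = ?t k"
    proof (cases "k \<le> b")
      case True
      then have "x ^ (a + b - k) = x ^ (a - k) * x ^ k * x ^ (b - k)"
        using k by (simp flip: power_add)
      then show ?thesis by (simp add: poly_monom power_mult_distrib)
    qed (simp add: binomial_eq_0)
  qed
  also have "\<dots> = (\<Sum>k\<le>max a N. ?t k)"
    by (rule sum.mono_neutral_left) (auto simp: binomial_eq_0)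
  also have "\<dots> = (\<Sum>k\<le>N. ?t k)"
    by (rule sum.mono_neutral_right) (use assms in \<open>auto simp: binomial_eq_0\<close>)
  finally show ?thesis .
qed

text \<open>Pairing equal powers of \<open>t\<close> extracts the constant term of
  \<open>f (x + t) g (x + x (1+x) / t)\<close>; by bilinearity the monomial case suffices.\<close>

lemma poly_diamond:
  assumes "degree g \<le> N"
  shows "poly (diamond f g) x =
    (\<Sum>k\<le>N. coeff (pcompose f [:x, 1:]) k * coeff (pcompose g [:x, x * (1 + x):]) k)"
proof -
  have "poly (diamond f g) x = (\<Sum>a\<le>degree f. \<Sum>b\<le>degree g. \<Sum>k\<le>N.
      (coeff f a * (real (a choose k) * x ^ (a - k))) *
      (coeff g b * (real (b choose k) * (x * (1 + x)) ^ k * x ^ (b - k))))"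
    unfolding diamond_def poly_sum poly_smult
  proof (intro sum.cong refl)
    fix a b assume "b \<in> {..degree g}"
    then have "b \<le> N" using assms by simp
    then show "coeff f a * coeff g b * poly (diamond_monom a b) x = (\<Sum>k\<le>N.
      (coeff f a * (real (a choose k) * x ^ (a - k))) *
      (coeff g b * (real (b choose k) * (x * (1 + x)) ^ k * x ^ (b - k))))"
      by (simp add: poly_diamond_monom sum_distrib_left ac_simps)
  qed
  also have "\<dots> = (\<Sum>a\<le>degree f. \<Sum>k\<le>N. \<Sum>b\<le>degree g.
      (coeff f a * (real (a choose k) * x ^ (a - k))) *
      (coeff g b * (real (b choose k) * (x * (1 + x)) ^ k * x ^ (b - k))))"
    by (intro sum.cong refl sum.swap)
  also have "\<dots> = (\<Sum>k\<le>N. \<Sum>a\<le>degree f. \<Sum>b\<le>degree g.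
      (coeff f a * (real (a choose k) * x ^ (a - k))) *
      (coeff g b * (real (b choose k) * (x * (1 + x)) ^ k * x ^ (b - k))))"
    by (rule sum.swap)
  finally show ?thesis unfolding coeff_pcompose_linear sum_product by simp
qed

section \<open>Gamma cones and weighted homogeneity over a semiring of coefficients\<close>

locale coeff_semiring =
  fixes K :: "real set"
  assumes zero_in: "0 \<in> K" and one_in: "1 \<in> K"
    and add_in: "a \<in> K \<Longrightarrow> b \<in> K \<Longrightarrow> a + b \<in> K"
    and mult_in: "a \<in> K \<Longrightarrow> b \<in> K \<Longrightarrow> a * b \<in> K"
begin

text \<open>Members are functions of \<open>x\<close>, because in \<open>homogeneous\<close> the
  point \<open>x\<close> is a parameter of polynomials in \<open>t\<close>.\<close>

definition cone :: "nat \<Rightarrow> (real \<Rightarrow> real) set" where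
  "cone n = {F. \<exists>\<gamma>. (\<forall>i. \<gamma> i \<in> K) \<and>
     F = (\<lambda>x. \<Sum>i\<le>n div 2. \<gamma> i * ((x * (1 + x)) ^ i * (1 + 2 * x) ^ (n - 2 * i)))}"

lemma cone_zero: "(\<lambda>x. 0) \<in> cone n"
  unfolding cone_def by (auto intro!: exI[of _ "\<lambda>_. 0"] simp: zero_in)

lemma cone_add:
  assumes "F \<in> cone n" "G \<in> cone n"
  shows "(\<lambda>x. F x + G x) \<in> cone n"
proof -
  obtain \<gamma> \<delta> where K: "\<And>i. \<gamma> i \<in> K" "\<And>i. \<delta> i \<in> K"
    and F: "F = (\<lambda>x. \<Sum>i\<le>n div 2. \<gamma> i * ((x * (1 + x)) ^ i * (1 + 2 * x) ^ (n - 2 * i)))"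
    and G: "G = (\<lambda>x. \<Sum>i\<le>n div 2. \<delta> i * ((x * (1 + x)) ^ i * (1 + 2 * x) ^ (n - 2 * i)))"
    using assms unfolding cone_def by blast
  then show ?thesis unfolding cone_def F G
    by (auto intro!: exI[of _ "\<lambda>i. \<gamma> i + \<delta> i"] add_in simp: distrib_right sum.distrib)
qed

lemma cone_scale:
  assumes "c \<in> K" "F \<in> cone n"
  shows "(\<lambda>x. c * F x) \<in> cone n"
proof -
  obtain \<gamma> where K: "\<And>i. \<gamma> i \<in> K"
    and F: "F = (\<lambda>x. \<Sum>i\<le>n div 2. \<gamma> i * ((x * (1 + x)) ^ i * (1 + 2 * x) ^ (n - 2 * i)))"
    using assms unfolding cone_def by blast
  then show ?thesis unfolding cone_def F using assms(1)
    by (auto intro!: exI[of _ "\<lambda>i. c * \<gamma> i"] mult_in simp: sum_distrib_left mult.assoc)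
qed

lemma cone_sum:
  assumes "\<And>i. i \<in> I \<Longrightarrow> F i \<in> cone n"
  shows "(\<lambda>x. \<Sum>i\<in>I. F i x) \<in> cone n"
  using assms
  by (induction I rule: infinite_finite_induct) (auto intro: cone_zero cone_add)

lemma cone_monom:
  assumes "n = 2 * i + m"
  shows "(\<lambda>x. (x * (1 + x)) ^ i * (1 + 2 * x) ^ m) \<in> cone n"
proof -
  have "(\<Sum>j\<le>n div 2. (if j = i then 1 else 0) *
      ((x * (1 + x)) ^ j * (1 + 2 * x) ^ (n - 2 * j))) =
      (x * (1 + x)) ^ i * (1 + 2 * x) ^ m" for x :: real
    using assms by (simp add: if_distrib[of "\<lambda>c. c * _"] sum.delta' cong: if_cong)
  then show ?thesis unfolding cone_def
    by (auto intro!: exI[of _ "\<lambda>j. if j = i then 1 else 0"] zero_in one_in)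
qed

lemma cone_mult:
  assumes "F \<in> cone m" "G \<in> cone n"
  shows "(\<lambda>x. F x * G x) \<in> cone (m + n)"
proof -
  obtain \<gamma> \<delta> where K: "\<And>i. \<gamma> i \<in> K" "\<And>i. \<delta> i \<in> K"
    and F: "F = (\<lambda>x. \<Sum>i\<le>m div 2. \<gamma> i * ((x * (1 + x)) ^ i * (1 + 2 * x) ^ (m - 2 * i)))"
    and G: "G = (\<lambda>x. \<Sum>i\<le>n div 2. \<delta> i * ((x * (1 + x)) ^ i * (1 + 2 * x) ^ (n - 2 * i)))"
    using assms unfolding cone_def by blast
  have eq: "F x * G x = (\<Sum>i\<le>m div 2. \<Sum>j\<le>n div 2. (\<gamma> i * \<delta> j) *
      ((x * (1 + x)) ^ (i + j) * (1 + 2 * x) ^ ((m - 2 * i) + (n - 2 * j))))" for x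
    unfolding F G sum_product power_add by (intro sum.cong refl) (simp only: ac_simps)
  show ?thesis unfolding eq
    by (intro cone_sum cone_scale cone_monom mult_in K) auto
qed

text \<open>Here the polynomial variable and \<open>1 + 2 x\<close> have weight one, and \<open>x (1 + x)\<close> has
  weight two.\<close>

definition homogeneous :: "nat \<Rightarrow> (real \<Rightarrow> real poly) \<Rightarrow> bool" where
  "homogeneous n P \<longleftrightarrow> (\<forall>k. (k \<le> n \<longrightarrow> (\<lambda>x. coeff (P x) k) \<in> cone (n - k)) \<and>
     (k > n \<longrightarrow> (\<forall>x. coeff (P x) k = 0)))"

lemma homogeneous_mult:
  assumes "homogeneous m P" "homogeneous n Q"
  shows "homogeneous (m + n) (\<lambda>x. P x * Q x)"
  unfolding homogeneous_def
proof (intro allI conjI impI)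
  fix k assume k: "k \<le> m + n"
  have "(\<lambda>x. \<Sum>i\<le>k. coeff (P x) i * coeff (Q x) (k - i)) \<in> cone (m + n - k)"
  proof (rule cone_sum)
    fix i assume "i \<in> {..k}"
    show "(\<lambda>x. coeff (P x) i * coeff (Q x) (k - i)) \<in> cone (m + n - k)"
    proof (cases "i \<le> m \<and> k - i \<le> n")
      case True
      then have "m + n - k = (m - i) + (n - (k - i))" using \<open>i \<in> {..k}\<close> by auto
      then show ?thesis using True assms unfolding homogeneous_def by (metis cone_mult)
    next
      case False
      then have "(\<lambda>x. coeff (P x) i * coeff (Q x) (k - i)) = (\<lambda>x. 0)"
        using assms unfolding homogeneous_def by (auto simp: not_le)
      then show ?thesis by (simp only: cone_zero)
    qed
  qed
  then show "(\<lambda>x. coeff (P x * Q x) k) \<in> cone (m + n - k)" by (simp add: coeff_mult)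
next
  fix k x assume k: "k > m + n"
  have "coeff (P x) i * coeff (Q x) (k - i) = 0" for i
  proof (cases "i > m")
    case False
    then have "k - i > n" using k by simp
    then show ?thesis using assms(2) by (simp add: homogeneous_def)
  qed (use assms(1) in \<open>simp add: homogeneous_def\<close>)
  then show "coeff (P x * Q x) k = 0" unfolding coeff_mult by (intro sum.neutral ballI)
qed

lemma homogeneous_power:
  assumes "homogeneous m P"
  shows "homogeneous (m * n) (\<lambda>x. P x ^ n)"
proof (induction n)
  case 0
  show ?case using cone_monom[of 0 0 0] by (auto simp: homogeneous_def)
next
  case (Suc n)
  then show ?case using homogeneous_mult[OF assms Suc.IH] by simp
qed

lemma homogeneous_pCons:
  assumes "F \<in> cone (Suc n)" "homogeneous n P"
  shows "homogeneous (Suc n) (\<lambda>x. pCons (F x) (P x))"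
  unfolding homogeneous_def
proof
  fix k
  show "(k \<le> Suc n \<longrightarrow> (\<lambda>x. coeff (pCons (F x) (P x)) k) \<in> cone (Suc n - k)) \<and>
      (Suc n < k \<longrightarrow> (\<forall>x. coeff (pCons (F x) (P x)) k = 0))"
    using assms by (cases k) (auto simp: homogeneous_def)
qed

lemma homogeneous_const:
  assumes "F \<in> cone n"
  shows "homogeneous n (\<lambda>x. [:F x:])"
  unfolding homogeneous_def
proof
  fix k
  show "(k \<le> n \<longrightarrow> (\<lambda>x. coeff [:F x:] k) \<in> cone (n - k)) \<and> (n < k \<longrightarrow> (\<forall>x. coeff [:F x:] k = 0))"
    using assms cone_zero by (cases k) auto
qed

lemma of_nat_in: "real n \<in> K"
  by (induction n) (auto intro: zero_in one_in add_in)

lemma cone_numeral_monom: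
  "n = 2 * i + m \<Longrightarrow> (\<lambda>x. real c * ((x * (1 + x)) ^ i * (1 + 2 * x) ^ m)) \<in> cone n"
  by (intro cone_scale of_nat_in cone_monom)

text \<open>The first two are the images of \<open>x (1+x)\<close> and \<open>1 + 2 x\<close> under
  \<open>x\<close> to \<open>x + t\<close>; the last two are those under \<open>x\<close> to
  \<open>x + x (1+x) / t\<close>, cleared of denominators by \<open>t^2\<close> and
  \<open>t\<close>.\<close>

lemma homogeneous_factors:
  "homogeneous 2 (\<lambda>x. [:x * (1 + x), 1 + 2 * x, 1:])"
  "homogeneous 1 (\<lambda>x. [:1 + 2 * x, 2:])"
  "homogeneous 4 (\<lambda>x. smult (x * (1 + x)) [:x * (1 + x), 1 + 2 * x, 1:])"
  "homogeneous 2 (\<lambda>x. [:2 * (x * (1 + x)), 1 + 2 * x:])"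
proof -
  have c: "(\<lambda>x. 1) \<in> cone 0" "(\<lambda>x. 2) \<in> cone 0" "(\<lambda>x. 1 + 2 * x) \<in> cone 1"
    "(\<lambda>x. x * (1 + x)) \<in> cone 2" "(\<lambda>x. 2 * (x * (1 + x))) \<in> cone 2"
    using cone_numeral_monom[of 0 0 0 1] cone_numeral_monom[of 0 0 0 2]
      cone_numeral_monom[of 1 0 1 1] cone_numeral_monom[of 2 1 0 1] cone_numeral_monom[of 2 1 0 2]
    by simp_all
  show h: "homogeneous 2 (\<lambda>x. [:x * (1 + x), 1 + 2 * x, 1:])"
    using homogeneous_pCons[OF _ homogeneous_pCons[OF _ homogeneous_const[OF c(1)]],
        of "\<lambda>x. x * (1 + x)" "\<lambda>x. 1 + 2 * x"] c by (simp add: numeral_2_eq_2)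
  show "homogeneous 1 (\<lambda>x. [:1 + 2 * x, 2:])"
    using homogeneous_pCons[OF _ homogeneous_const[OF c(2)], of "\<lambda>x. 1 + 2 * x"] c by simp
  have s: "homogeneous 2 (\<lambda>x. [:x * (1 + x):])"
    by (rule homogeneous_const[OF c(4)])
  show "homogeneous 4 (\<lambda>x. smult (x * (1 + x)) [:x * (1 + x), 1 + 2 * x, 1:])"
    using homogeneous_mult[OF s h] by (simp add: mult.commute)
  have "homogeneous 1 (\<lambda>x. [:1 + 2 * x:])"
    by (rule homogeneous_const[OF c(3)])
  then show "homogeneous 2 (\<lambda>x. [:2 * (x * (1 + x)), 1 + 2 * x:])"
    using homogeneous_pCons[of "\<lambda>x. 2 * (x * (1 + x))" 1 "\<lambda>x. [:1 + 2 * x:]"] c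
    by (simp add: numeral_2_eq_2)
qed

end

section \<open>Symmetric polynomials and gamma expansions\<close>

definition gamma_poly :: "nat \<Rightarrow> (nat \<Rightarrow> real) \<Rightarrow> real poly" where
  "gamma_poly s \<gamma> = (\<Sum>i\<le>s div 2. smult (\<gamma> i) (monom 1 i * [:1, 1:] ^ (s - 2 * i)))"

lemma poly_gamma_poly:
  "poly (gamma_poly s \<gamma>) x = (\<Sum>i\<le>s div 2. \<gamma> i * (x ^ i * (1 + x) ^ (s - 2 * i)))"
  by (simp add: gamma_poly_def poly_sum poly_monom)

lemma degree_gamma_poly_le: "degree (gamma_poly s \<gamma>) \<le> s"
  unfolding gamma_poly_def
proof (intro degree_sum_le finite_atMost order_trans[OF degree_smult_le])
  fix i assume "i \<in> {..s div 2}"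
  then show "degree (monom 1 i * [:1, 1:] ^ (s - 2 * i) :: real poly) \<le> s"
    by (intro order_trans[OF degree_mult_le])
      (simp add: degree_monom_eq degree_power_eq)
qed

lemma symmetric_center_gamma_poly: "symmetric_center s (gamma_poly s \<gamma>)"
proof -
  have "reversal s (gamma_poly s \<gamma>) = gamma_poly s \<gamma>"
  proof (rule poly_eqI_except[of 0])
    fix x :: real assume x: "x \<noteq> 0"
    have "x ^ s * (\<gamma> i * ((1 / x) ^ i * (1 + 1 / x) ^ (s - 2 * i))) =
        \<gamma> i * (x ^ i * (1 + x) ^ (s - 2 * i))" if "i \<le> s div 2" for i
    proof -
      \<comment> \<open>Of the \<open>s\<close> factors \<open>x\<close>, \<open>i\<close> cancel
        the powers of \<open>1 / x\<close>, \<open>i\<close> remain as \<open>x ^ i\<close>, and the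
        others turn each \<open>1 + 1 / x\<close> into \<open>1 + x\<close>.\<close>
      have "s = i + i + (s - 2 * i)" using that by simp
      then have "x ^ s = x ^ i * x ^ i * x ^ (s - 2 * i)" by (metis power_add)
      moreover have "x ^ (s - 2 * i) * (1 + 1 / x) ^ (s - 2 * i) = (1 + x) ^ (s - 2 * i)"
        using x by (simp add: distrib_left add.commute flip: power_mult_distrib)
      moreover have "x ^ i * (1 / x) ^ i = 1"
        using x by (simp flip: power_mult_distrib)
      moreover have "x ^ s * (\<gamma> i * ((1 / x) ^ i * (1 + 1 / x) ^ (s - 2 * i))) =
          \<gamma> i * (x ^ i * (x ^ i * (1 / x) ^ i) * (x ^ (s - 2 * i) * (1 + 1 / x) ^ (s - 2 * i)))"
        unfolding calculation(1) by (simp only: ac_simps)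
      ultimately show ?thesis by (simp only: mult_1_right)
    qed
    then show "poly (reversal s (gamma_poly s \<gamma>)) x = poly (gamma_poly s \<gamma>) x"
      unfolding poly_reversal[OF degree_gamma_poly_le x] poly_gamma_poly sum_distrib_left
      by (intro sum.cong) auto
  qed
  then show ?thesis by (simp add: symmetric_center_def degree_gamma_poly_le)
qed

lemma coeff_reversal:
  assumes "degree a \<le> s" "k \<le> s"
  shows "coeff (reversal s a) k = coeff a (s - k)"
proof (cases "k < s - degree a")
  case True
  then show ?thesis using assms by (simp add: reversal_def coeff_monom_mult coeff_eq_0)
next
  case False
  then show ?thesis using assms
    by (auto simp: reversal_def coeff_monom_mult coeff_reflect_poly)
qed

lemma symmetric_center_iff_coeff:
  "symmetric_center s a \<longleftrightarrow> degree a \<le> s \<and> (\<forall>k\<le>s. coeff a k = coeff a (s - k))"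
proof -
  have "reversal s a = a \<longleftrightarrow> (\<forall>k\<le>s. coeff a k = coeff a (s - k))" if d: "degree a \<le> s"
  proof
    assume "reversal s a = a"
    then show "\<forall>k\<le>s. coeff a k = coeff a (s - k)" using coeff_reversal[OF d] by metis
  next
    assume *: "\<forall>k\<le>s. coeff a k = coeff a (s - k)"
    have "degree (reversal s a) \<le> s"
      unfolding reversal_def using d degree_reflect_poly_le[of a]
      by (intro order_trans[OF degree_mult_le]) (simp add: degree_monom_eq)
    then show "reversal s a = a"
      using * d coeff_reversal[OF d] by (intro poly_eqI) (metis coeff_eq_0 le_less_trans not_le)
  qed
  then show ?thesis unfolding symmetric_center_def by blast
qed

text \<open>Subtracting \<open>coeff a 0\<close> times \<open>(1+x)^s\<close> kills the constant
  term and, by symmetry, the one of degree \<open>s\<close>. The rest is \<open>x\<close> times a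
  polynomial symmetric for \<open>s - 2\<close>, to which induction applies.\<close>

lemma symmetric_center_imp_gamma_poly:
  assumes "symmetric_center s a"
  shows "\<exists>\<gamma>. a = gamma_poly s \<gamma>"
  using assms
proof (induction s arbitrary: a rule: less_induct)
  case (less s)
  have sym: "degree a \<le> s" "\<And>k. k \<le> s \<Longrightarrow> coeff a k = coeff a (s - k)"
    using less.prems unfolding symmetric_center_iff_coeff by blast+
  show ?case
  proof (cases "s < 2")
    case True
    \<comment> \<open>For \<open>s < 2\<close> the only possible indices are \<open>0\<close> and
      \<open>s\<close>, and their coefficients agree.\<close>
    have "a = smult (coeff a 0) ([:1, 1:] ^ s)"
    proof (rule poly_eqI)
      fix k
      show "coeff a k = coeff (smult (coeff a 0) ([:1, 1:] ^ s)) k"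
      proof (cases "k \<le> s")
        case k: True
        have "k = 0 \<or> k = s" using k True by auto
        then show ?thesis using sym(2)[of 0]
          by (auto simp: coeff_linear_poly_power')
      next
        case False
        then show ?thesis using sym(1)
          by (simp add: coeff_linear_poly_power' coeff_eq_0 binomial_eq_0)
      qed
    qed
    then have "a = gamma_poly s (\<lambda>_. coeff a 0)"
      using True by (simp add: gamma_poly_def)
    then show ?thesis by blast
  next
    case False
    define b where "b = a - smult (coeff a 0) ([:1, 1:] ^ s)"
    define c where "c = poly_shift 1 b"
    have b: "coeff b k = coeff a k - coeff a 0 * real (s choose k)" for k
      by (simp add: b_def coeff_linear_poly_power')
    have bs: "coeff b k = coeff b (s - k)" if "k \<le> s" for k
      unfolding b sym(2)[OF that] using binomial_symmetric[OF that] by simp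
    have b0: "coeff b 0 = 0" by (simp add: b)
    have bz: "coeff b k = 0" if "k \<ge> s" for k
      using that sym(1) bs[of 0] b0 by (cases "k = s") (auto simp: b coeff_eq_0 binomial_eq_0)
    have bc: "b = monom 1 1 * c"
      by (rule poly_eqI) (auto simp: c_def coeff_monom_mult coeff_poly_shift b0)
    have cc: "coeff c k = coeff b (Suc k)" for k by (simp add: c_def coeff_poly_shift)
    have "symmetric_center (s - 2) c"
      unfolding symmetric_center_iff_coeff
    proof (intro conjI allI impI degree_le)
      fix k assume "k > s - 2"
      then show "coeff c k = 0" using bz False by (simp add: cc)
    next
      fix k assume k: "k \<le> s - 2"
      then have "s - Suc k = Suc (s - 2 - k)" using False by simp
      then show "coeff c k = coeff c (s - 2 - k)" using bs[of "Suc k"] k False by (simp add: cc)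
    qed
    then obtain \<gamma> where g: "c = gamma_poly (s - 2) \<gamma>" using less.IH[of "s - 2" c] False by auto
    \<comment> \<open>Multiplying by \<open>x\<close> raises each gamma index by one and keeps the
      exponent of \<open>1 + x\<close>, so index \<open>0\<close> is free for the subtracted
      term.\<close>
    define \<delta> where "\<delta> = (\<lambda>i. case i of 0 \<Rightarrow> coeff a 0 | Suc j \<Rightarrow> \<gamma> j)"
    have sd: "s div 2 = Suc ((s - 2) div 2)" using False by presburger
    have "gamma_poly s \<delta> = smult (coeff a 0) ([:1, 1:] ^ s) +
        (\<Sum>i\<le>(s - 2) div 2. smult (\<gamma> i) (monom 1 (Suc i) * [:1, 1:] ^ (s - 2 - 2 * i)))"
      unfolding gamma_poly_def sd sum.atMost_Suc_shift by (simp add: \<delta>_def)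
    also have "\<dots> = smult (coeff a 0) ([:1, 1:] ^ s) + monom 1 1 * c"
      unfolding g gamma_poly_def sum_distrib_left by (simp add: monom_Suc)
    also have "\<dots> = a" unfolding bc[symmetric] by (simp add: b_def)
    finally show ?thesis by metis
  qed
qed

section \<open>The gamma basis under the binomial transform, and its pairing\<close>

definition transformed_basis :: "nat \<Rightarrow> nat \<Rightarrow> nat \<Rightarrow> real poly" where
  "transformed_basis r i m = [:1, 1:] ^ r * ([:0, 1, 1:] ^ i * [:1, 2:] ^ m)"

lemma poly_transformed_basis:
  "poly (transformed_basis r i m) x = (1 + x) ^ r * ((x * (1 + x)) ^ i * (1 + 2 * x) ^ m)"
  by (simp add: transformed_basis_def mult.commute)

text \<open>At \<open>x / (1+x)\<close> the factor \<open>1 + x\<close> becomes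
  \<open>(1 + 2 x) / (1 + x)\<close>. Of the \<open>d\<close> factors \<open>1 + x\<close> in front,
  \<open>s\<close> are absorbed, two for each basis factor \<open>x\<close> and one for each
  \<open>1 + x\<close>, and \<open>r\<close> remain.\<close>

lemma poly_binom_transform_gamma_poly:
  assumes "d = r + s" "x \<noteq> -1"
  shows "poly (binom_transform d (gamma_poly s \<gamma>)) x = (1 + x) ^ r *
    (\<Sum>i\<le>s div 2. \<gamma> i * ((x * (1 + x)) ^ i * (1 + 2 * x) ^ (s - 2 * i)))"
proof -
  have x: "1 + x \<noteq> 0" using assms(2) by (metis add.inverse_inverse add_eq_0_iff2 add.commute)
  have t: "(1 + x) ^ s * (\<gamma> i * ((x / (1 + x)) ^ i * (1 + x / (1 + x)) ^ (s - 2 * i))) =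
      \<gamma> i * ((x * (1 + x)) ^ i * (1 + 2 * x) ^ (s - 2 * i))" if "i \<le> s div 2" for i
  proof -
    have "s = i + i + (s - 2 * i)" using that by simp
    then have "(1 + x) ^ s = (1 + x) ^ i * (1 + x) ^ i * (1 + x) ^ (s - 2 * i)"
      by (metis power_add)
    moreover have "(1 + x) ^ (s - 2 * i) * (1 + x / (1 + x)) ^ (s - 2 * i) = (1 + 2 * x) ^ (s - 2 * i)"
      using x by (simp add: distrib_left add.commute flip: power_mult_distrib)
    moreover have "(1 + x) ^ i * (1 + x) ^ i * (x / (1 + x)) ^ i = (x * (1 + x)) ^ i"
      using x by (simp add: mult.commute flip: power_mult_distrib)
    moreover have "(1 + x) ^ s * (\<gamma> i * ((x / (1 + x)) ^ i * (1 + x / (1 + x)) ^ (s - 2 * i))) =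
        \<gamma> i * (((1 + x) ^ i * (1 + x) ^ i * (x / (1 + x)) ^ i) *
          ((1 + x) ^ (s - 2 * i) * (1 + x / (1 + x)) ^ (s - 2 * i)))"
      unfolding calculation(1) by (simp only: ac_simps)
    ultimately show ?thesis by (simp only:)
  qed
  have "degree (gamma_poly s \<gamma>) \<le> d" using degree_gamma_poly_le[of s \<gamma>] assms(1) by simp
  from poly_binom_transform[OF this assms(2)]
  have "poly (binom_transform d (gamma_poly s \<gamma>)) x = (1 + x) ^ r *
      (\<Sum>i\<le>s div 2. (1 + x) ^ s * (\<gamma> i * ((x / (1 + x)) ^ i * (1 + x / (1 + x)) ^ (s - 2 * i))))"
    unfolding poly_gamma_poly sum_distrib_left[symmetric]
    by (simp only: assms(1) power_add mult.assoc)
  also have "\<dots> = (1 + x) ^ r *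
      (\<Sum>i\<le>s div 2. \<gamma> i * ((x * (1 + x)) ^ i * (1 + 2 * x) ^ (s - 2 * i)))"
    using sum.cong[OF refl t, of "{..s div 2}"] by simp
  finally show ?thesis .
qed

lemma binom_transform_gamma_poly:
  "binom_transform (r + s) (gamma_poly s \<gamma>) =
    (\<Sum>i\<le>s div 2. smult (\<gamma> i) (transformed_basis r i (s - 2 * i)))"
proof (rule poly_eqI_except[of "-1"])
  fix x :: real assume "x \<noteq> -1"
  then show "poly (binom_transform (r + s) (gamma_poly s \<gamma>)) x =
      poly (\<Sum>i\<le>s div 2. smult (\<gamma> i) (transformed_basis r i (s - 2 * i))) x"
    by (simp add: poly_binom_transform_gamma_poly poly_sum poly_transformed_basis
        sum_distrib_left mult.left_commute)
qed

lemma pcompose_power: "pcompose (f ^ n) g = pcompose f g ^ n" for f g :: "real poly"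
  by (induction n) (simp_all add: pcompose_1 pcompose_mult)

lemma pcompose_transformed_basis_shift:
  "pcompose (transformed_basis r i m) [:x, 1:] =
    [:1 + x, 1:] ^ r * ([:x * (1 + x), 1 + 2 * x, 1:] ^ i * [:1 + 2 * x, 2:] ^ m)"
  by (simp add: transformed_basis_def pcompose_mult pcompose_power pcompose_pCons algebra_simps)

lemma degree_transformed_basis_le: "degree (transformed_basis r i m) \<le> r + (2 * i + m)"
  unfolding transformed_basis_def
  by (simp add: degree_mult_eq degree_power_eq)

lemma reversal_transformed_basis:
  assumes N: "N = r + (2 * i + m)" and y: "y = x * (1 + x)"
  shows "reversal N (pcompose (transformed_basis r i m) [:x, y:]) =
    smult ((1 + x) ^ r) ([:x, 1:] ^ r *
      (smult y [:y, 1 + 2 * x, 1:] ^ i * [:2 * y, 1 + 2 * x:] ^ m))"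
proof (rule poly_eqI_except[of 0])
  fix t :: real assume t: "t \<noteq> 0"
  have d: "degree (pcompose (transformed_basis r i m) [:x, y:]) \<le> N"
    using degree_transformed_basis_le[of r i m] unfolding N
    by (simp add: degree_pcompose split: if_splits)
  let ?X = "x + y / t"
  have X: "poly [:x, y:] (1 / t) = ?X" by simp
  \<comment> \<open>The choice \<open>y = x (1+x)\<close> makes both \<open>t (1 + ?X)\<close> and
    \<open>t ?X\<close> factor.\<close>
  have a: "t * (1 + ?X) = (1 + x) * (x + t)"
    using t y by (simp add: field_simps)
  have b: "t * t * (?X * (1 + ?X)) = y * (y + t * (1 + 2 * x) + t * t)"
  proof -
    have "t * ?X = x * (t + (1 + x))" using t y by (simp add: field_simps)
    then have "t * t * (?X * (1 + ?X)) = x * (t + (1 + x)) * ((1 + x) * (x + t))"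
      using a by (metis mult.assoc mult.left_commute)
    then show ?thesis by (simp add: y algebra_simps)
  qed
  have c: "t * (1 + 2 * ?X) = 2 * y + t * (1 + 2 * x)"
    using t by (simp add: field_simps)
  have "poly (reversal N (pcompose (transformed_basis r i m) [:x, y:])) t =
      t ^ N * poly (transformed_basis r i m) ?X"
    by (simp only: poly_reversal[OF d t] poly_pcompose X)
  also have "\<dots> = (t * (1 + ?X)) ^ r * ((t * t * (?X * (1 + ?X))) ^ i * (t * (1 + 2 * ?X)) ^ m)"
    unfolding N poly_transformed_basis power_add power_mult power_mult_distrib power2_eq_square
    by (simp only: ac_simps)
  also have "\<dots> = ((1 + x) * (x + t)) ^ r * ((y * (y + t * (1 + 2 * x) + t * t)) ^ i *
      (2 * y + t * (1 + 2 * x)) ^ m)"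
    unfolding a b c ..
  also have "\<dots> = poly (smult ((1 + x) ^ r) ([:x, 1:] ^ r *
      (smult y [:y, 1 + 2 * x, 1:] ^ i * [:2 * y, 1 + 2 * x:] ^ m))) t"
  proof -
    have h: "poly [:y, 1 + 2 * x, 1:] t = y + t * (1 + 2 * x) + t * t"
      "poly [:2 * y, 1 + 2 * x:] t = 2 * y + t * (1 + 2 * x)" "poly [:x, 1:] t = x + t"
      by (simp_all add: algebra_simps)
    show ?thesis unfolding poly_smult poly_mult poly_power h power_mult_distrib
      by (simp only: ac_simps)
  qed
  finally show "poly (reversal N (pcompose (transformed_basis r i m) [:x, y:])) t = \<dots>" .
qed

text \<open>Reversing one factor turns the matching of equal indices into a convolution, that is,
  one coefficient of an explicit product.\<close>

lemma sum_coeff_mult_eq_reversal: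
  assumes "degree b \<le> N"
  shows "(\<Sum>k\<le>N. coeff a k * coeff b k) = coeff (a * reversal N b) N"
  unfolding coeff_mult by (intro sum.cong refl) (simp add: coeff_reversal[OF assms])

text \<open>The product of \<open>f (x + t)\<close> and \<open>g (x + x (1 + x) / t)\<close> for basis elements \<open>f\<close>, \<open>g\<close>,
  cleared of denominators and of the factor \<open>(1 + x)\<^sup>r\<close>.\<close>

definition kernel_poly :: "nat \<Rightarrow> nat \<Rightarrow> nat \<Rightarrow> nat \<Rightarrow> nat \<Rightarrow> real \<Rightarrow> real poly" where
  "kernel_poly r i m j n x = [:x * (1 + x), 1 + 2 * x, 1:] ^ (r + i) * ([:1 + 2 * x, 2:] ^ m *
     (smult (x * (1 + x)) [:x * (1 + x), 1 + 2 * x, 1:] ^ j * [:2 * (x * (1 + x)), 1 + 2 * x:] ^ n))"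

lemma pairing_transformed_basis:
  assumes N: "N = r + (2 * j + n)"
  shows "(\<Sum>k\<le>N. coeff (pcompose (transformed_basis r i m) [:x, 1:]) k *
      coeff (pcompose (transformed_basis r j n) [:x, x * (1 + x):]) k) =
    (1 + x) ^ r * coeff (kernel_poly r i m j n x) N"
proof -
  have "degree (pcompose (transformed_basis r j n) [:x, x * (1 + x):]) \<le> N"
    using degree_transformed_basis_le[of r j n] unfolding N
    by (simp add: degree_pcompose split: if_splits)
  note sum_coeff_mult_eq_reversal[OF this]
  moreover have "pcompose (transformed_basis r i m) [:x, 1:] *
      reversal N (pcompose (transformed_basis r j n) [:x, x * (1 + x):]) =
      smult ((1 + x) ^ r) (kernel_poly r i m j n x)"
  proof -
    \<comment> \<open>The \<open>r\<close> factors \<open>1 + x + t\<close> from the first shift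
      meet the \<open>r\<close> factors \<open>x + t\<close> from the reversed second one; each pair
      gives this quadratic, hence the exponent \<open>r + i\<close>.\<close>
    have "[:x * (1 + x), 1 + 2 * x, 1:] = [:1 + x, 1:] * [:x, 1:]"
      by (simp add: algebra_simps)
    then have "[:x * (1 + x), 1 + 2 * x, 1:] ^ (r + i) =
        [:1 + x, 1:] ^ r * [:x, 1:] ^ r * [:x * (1 + x), 1 + 2 * x, 1:] ^ i"
      unfolding power_add by (simp only: power_mult_distrib)
    then show ?thesis
      unfolding pcompose_transformed_basis_shift reversal_transformed_basis[OF N refl]
        kernel_poly_def mult_smult_right by (simp only: ac_simps)
  qed
  ultimately show ?thesis by simp
qed

section \<open>Gamma expansion of the product\<close>

context coeff_semiring
begin

lemma kernel_poly_in_cone: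
  assumes "N = r + (2 * j + n)"
  shows "(\<lambda>x. coeff (kernel_poly r i m j n x) N) \<in> cone (r + (2 * i + m) + (2 * j + n))"
proof -
  have "homogeneous (2 * (r + i) + (1 * m + (4 * j + 2 * n))) (kernel_poly r i m j n)"
    unfolding kernel_poly_def by (intro homogeneous_mult homogeneous_power homogeneous_factors)
  \<comment> \<open>Taking the coefficient of \<open>t^N\<close> lowers the total weight by
    \<open>N\<close>.\<close>
  moreover have "N \<le> 2 * (r + i) + (1 * m + (4 * j + 2 * n))"
    "2 * (r + i) + (1 * m + (4 * j + 2 * n)) - N = r + (2 * i + m) + (2 * j + n)"
    using assms by simp_all
  ultimately show ?thesis unfolding homogeneous_def by metis
qed

text \<open>The pairing is bilinear, so pairs of basis elements suffice, and the products
  \<open>\<gamma> i * \<delta> j\<close> stay in \<open>K\<close>.\<close>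

lemma diamond_gamma_poly:
  assumes "\<And>i. \<gamma> i \<in> K" "\<And>i. \<delta> i \<in> K"
  obtains F where "F \<in> cone (r + s + s')"
    and "\<And>x. poly (diamond (binom_transform (r + s) (gamma_poly s \<gamma>))
        (binom_transform (r + s') (gamma_poly s' \<delta>))) x = (1 + x) ^ r * F x"
proof -
  let ?N = "r + s'"
  define F where "F = (\<lambda>i j x. coeff (kernel_poly r i (s - 2 * i) j (s' - 2 * j) x) ?N)"
  have e: "2 * i + (t - 2 * i) = t" if "i \<le> t div 2" for i t :: nat using that by simp
  have Fc: "F i j \<in> cone (r + s + s')" if "i \<le> s div 2" "j \<le> s' div 2" for i j
    using kernel_poly_in_cone[of ?N r j "s' - 2 * j" i "s - 2 * i"] e[OF that(1)] e[OF that(2)]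
    unfolding F_def by simp
  let ?G = "\<lambda>x. \<Sum>i\<le>s div 2. \<Sum>j\<le>s' div 2. (\<gamma> i * \<delta> j) * F i j x"
  have G: "?G \<in> cone (r + s + s')"
  proof (intro cone_sum cone_scale mult_in assms)
    fix i j assume "i \<in> {..s div 2}" "j \<in> {..s' div 2}"
    then show "(\<lambda>x. F i j x) \<in> cone (r + s + s')" using Fc by simp
  qed
  have "poly (diamond (binom_transform (r + s) (gamma_poly s \<gamma>))
        (binom_transform (r + s') (gamma_poly s' \<delta>))) x = (1 + x) ^ r * ?G x" for x
  proof -
    let ?a = "\<lambda>i k. coeff (pcompose (transformed_basis r i (s - 2 * i)) [:x, 1:]) k"
    let ?b = "\<lambda>j k. coeff (pcompose (transformed_basis r j (s' - 2 * j)) [:x, x * (1 + x):]) k"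
    have F: "(\<Sum>k\<le>?N. ?a i k * ?b j k) = (1 + x) ^ r * F i j x" if "j \<le> s' div 2" for i j
      unfolding F_def by (rule pairing_transformed_basis) (simp only: e[OF that])
    have "poly (diamond (binom_transform (r + s) (gamma_poly s \<gamma>))
        (binom_transform (r + s') (gamma_poly s' \<delta>))) x =
        (\<Sum>k\<le>?N. (\<Sum>i\<le>s div 2. \<gamma> i * ?a i k) * (\<Sum>j\<le>s' div 2. \<delta> j * ?b j k))"
      unfolding poly_diamond[OF degree_binom_transform_le]
      unfolding binom_transform_gamma_poly pcompose_sum pcompose_smult coeff_sum coeff_smult ..
    also have "\<dots> = (\<Sum>k\<le>?N. \<Sum>i\<le>s div 2. \<Sum>j\<le>s' div 2. (\<gamma> i * \<delta> j) * (?a i k * ?b j k))"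
      unfolding sum_product by (intro sum.cong refl) (simp only: ac_simps)
    also have "\<dots> = (\<Sum>i\<le>s div 2. \<Sum>k\<le>?N. \<Sum>j\<le>s' div 2. (\<gamma> i * \<delta> j) * (?a i k * ?b j k))"
      by (rule sum.swap)
    also have "\<dots> = (\<Sum>i\<le>s div 2. \<Sum>j\<le>s' div 2. (\<gamma> i * \<delta> j) * (\<Sum>k\<le>?N. ?a i k * ?b j k))"
      unfolding sum_distrib_left by (rule sum.cong[OF refl]) (rule sum.swap)
    also have "\<dots> = (\<Sum>i\<le>s div 2. \<Sum>j\<le>s' div 2. (\<gamma> i * \<delta> j) * ((1 + x) ^ r * F i j x))"
      by (intro sum.cong refl) (simp only: F atMost_iff)
    also have "\<dots> = (1 + x) ^ r * ?G x"
      unfolding sum_distrib_left by (simp only: ac_simps)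
    finally show ?thesis .
  qed
  with G show ?thesis using that by blast
qed

lemma W_mult_gamma_poly:
  assumes nz: "p \<noteq> 0" "q \<noteq> 0"
    and deg: "degree p = r + s" "degree q = r + s'"
    and W: "W p = gamma_poly s \<gamma>" "W q = gamma_poly s' \<delta>"
    and K: "\<And>i. \<gamma> i \<in> K" "\<And>i. \<delta> i \<in> K"
  shows "\<exists>\<epsilon>. (\<forall>i. \<epsilon> i \<in> K) \<and> W (p * q) = gamma_poly (r + s + s') \<epsilon>"
proof -
  obtain F where F: "F \<in> cone (r + s + s')"
    "\<And>x. poly (diamond (binom_transform (r + s) (gamma_poly s \<gamma>))
        (binom_transform (r + s') (gamma_poly s' \<delta>))) x = (1 + x) ^ r * F x"
    using diamond_gamma_poly[where \<gamma> = \<gamma> and \<delta> = \<delta> and r = r and s = s and s' = s'] K by blast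
  then obtain \<epsilon> where e: "\<And>i. \<epsilon> i \<in> K" and
    Fe: "F = (\<lambda>x. \<Sum>i\<le>(r + s + s') div 2.
      \<epsilon> i * ((x * (1 + x)) ^ i * (1 + 2 * x) ^ (r + s + s' - 2 * i)))"
    unfolding cone_def by blast
  \<comment> \<open>The degree contains \<open>r\<close> twice: one copy is the new defect, the
    other joins \<open>s + s'\<close> in the new center.\<close>
  have D: "degree (p * q) = r + (r + s + s')" using nz deg by (simp add: degree_mult_eq)
  have "diamond (binom_transform (degree p) (W p)) (binom_transform (degree q) (W q)) =
      binom_transform (degree (p * q)) (gamma_poly (r + s + s') \<epsilon>)"
    unfolding W deg
  proof (rule poly_eqI_except[of "-1"])
    fix x :: real assume "x \<noteq> -1"
    from poly_binom_transform_gamma_poly[OF D this]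
    show "poly (diamond (binom_transform (r + s) (gamma_poly s \<gamma>))
        (binom_transform (r + s') (gamma_poly s' \<delta>))) x =
        poly (binom_transform (degree (p * q)) (gamma_poly (r + s + s') \<epsilon>)) x"
      by (simp only: F(2) Fe)
  qed
  then have "poly (p * q) (real n) =
      binom_eval n (binom_transform (degree (p * q)) (gamma_poly (r + s + s') \<epsilon>))" for n
    by (metis binom_eval_diamond poly_eq_binom_eval_W poly_mult)
  moreover have "degree (gamma_poly (r + s + s') \<epsilon>) \<le> degree (p * q)"
    using degree_gamma_poly_le[of "r + s + s'" \<epsilon>] D by linarith
  ultimately have "W (p * q) = gamma_poly (r + s + s') \<epsilon>" by (intro W_eqI)
  with e show ?thesis by blast
qed

end

section \<open>Symmetry, defect and gamma-positivity of \<open>W (p * q)\<close>\<close>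

lemma W_symmetricE:
  assumes "W_symmetric p"
  obtains s where "degree p = defect p + s" "symmetric_center s (W p)"
proof -
  let ?s = "THE s. s \<le> degree p \<and> symmetric_center s (W p)"
  have "?s \<le> degree p \<and> symmetric_center ?s (W p)"
    by (rule theI'[OF defect_center_unique[OF assms]])
  then show ?thesis using that[of ?s] by (simp add: defect_def)
qed

lemma W_symmetric_defectI:
  assumes "degree p = r + s" "symmetric_center s (W p)"
  shows "W_symmetric p" "defect p = r"
proof -
  show sym: "W_symmetric p" using assms unfolding W_symmetric_def by (metis le_add2)
  have "(THE s. s \<le> degree p \<and> symmetric_center s (W p)) = s"
    by (rule the1_equality[OF defect_center_unique[OF sym]]) (use assms in auto)
  then show "defect p = r" by (simp add: defect_def assms)
qed

text \<open>A nonzero polynomial has only one center, so the \<open>s\<close> quantified in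
  \<open>gamma_positive\<close> is the given one.\<close>

lemma gamma_positive_iff:
  assumes "a \<noteq> 0" "symmetric_center s a"
  shows "gamma_positive a \<longleftrightarrow> (\<exists>\<gamma>. (\<forall>i. \<gamma> i \<ge> 0) \<and> a = gamma_poly s \<gamma>)"
proof
  assume "gamma_positive a"
  then obtain t \<gamma> where t: "symmetric_center t a" "a = gamma_poly t \<gamma>" "\<forall>i\<le>t div 2. \<gamma> i \<ge> 0"
    unfolding gamma_positive_def gamma_poly_def by blast
  have "t = s" using symmetric_center_unique assms t(1) by blast
  \<comment> \<open>Clipping at zero leaves the summed coefficients alone and makes the whole
    sequence nonnegative, as membership in \<open>K\<close> for every index demands.\<close>
  moreover have "gamma_poly t \<gamma> = gamma_poly t (\<lambda>i. max 0 (\<gamma> i))"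
    unfolding gamma_poly_def using t(3) by (intro sum.cong refl) (simp add: max_def)
  ultimately show "\<exists>\<gamma>. (\<forall>i. \<gamma> i \<ge> 0) \<and> a = gamma_poly s \<gamma>"
    using t(2) by (intro exI[of _ "\<lambda>i. max 0 (\<gamma> i)"]) auto
next
  assume "\<exists>\<gamma>. (\<forall>i. \<gamma> i \<ge> 0) \<and> a = gamma_poly s \<gamma>"
  then show "gamma_positive a"
    unfolding gamma_positive_def using assms(2) by (auto simp: gamma_poly_def)
qed

theorem theorem1p3:
  fixes p q :: "real poly"
  assumes "W_symmetric p" and "W_symmetric q" and "defect p = defect q"
  shows "W_symmetric (p * q) \<and> defect (p * q) = defect p \<and> defect (p * q) = defect q \<and>
    (gamma_positive (W p) \<and> gamma_positive (W q) \<longrightarrow> gamma_positive (W (p * q)))"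
proof (cases "p = 0 \<or> q = 0")
  case True
  \<comment> \<open>The degree is \<open>0\<close>, so the truncated difference is \<open>0\<close>
    whatever center the description picks.\<close>
  have "defect 0 = 0" by (simp add: defect_def)
  then show ?thesis using True assms by auto
next
  case False
  then have nz: "p \<noteq> 0" "q \<noteq> 0" by auto
  obtain s where s: "degree p = defect p + s" "symmetric_center s (W p)"
    using W_symmetricE[OF assms(1)] .
  obtain s' where s': "degree q = defect p + s'" "symmetric_center s' (W q)"
    using W_symmetricE[OF assms(2)] assms(3) by metis
  let ?S = "defect p + s + s'"
  \<comment> \<open>The instance of all reals gives symmetry and defect, that of the nonnegative
    reals gamma-positivity.\<close>
  interpret full: coeff_semiring UNIV by standard auto
  interpret nonneg: coeff_semiring "{0..}" by standard auto
  obtain \<gamma> \<delta> where "W p = gamma_poly s \<gamma>" "W q = gamma_poly s' \<delta>"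
    using symmetric_center_imp_gamma_poly s(2) s'(2) by metis
  then obtain \<epsilon> where "W (p * q) = gamma_poly ?S \<epsilon>"
    using full.W_mult_gamma_poly[OF nz s(1) s'(1)] by blast
  then have sym: "symmetric_center ?S (W (p * q))"
    by (simp add: symmetric_center_gamma_poly)
  have "degree (p * q) = defect p + ?S" using nz s(1) s'(1) by (simp add: degree_mult_eq)
  note W_symmetric_defectI[OF this sym]
  moreover have "gamma_positive (W (p * q))" if pos: "gamma_positive (W p)" "gamma_positive (W q)"
  proof -
    obtain \<gamma> where g: "\<forall>i. \<gamma> i \<ge> 0" "W p = gamma_poly s \<gamma>"
      using iffD1[OF gamma_positive_iff[OF W_nonzero[OF nz(1)] s(2)] pos(1)] by blast
    obtain \<delta> where d: "\<forall>i. \<delta> i \<ge> 0" "W q = gamma_poly s' \<delta>"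
      using iffD1[OF gamma_positive_iff[OF W_nonzero[OF nz(2)] s'(2)] pos(2)] by blast
    have K: "\<And>i. \<gamma> i \<in> {0..}" "\<And>i. \<delta> i \<in> {0..}" using g(1) d(1) by simp_all
    have "\<exists>\<epsilon>. (\<forall>i. \<epsilon> i \<ge> 0) \<and> W (p * q) = gamma_poly ?S \<epsilon>"
      using nonneg.W_mult_gamma_poly[OF nz s(1) s'(1) g(2) d(2) K] by simp
    moreover have "W (p * q) \<noteq> 0" using nz by (simp add: W_nonzero)
    ultimately show ?thesis using iffD2[OF gamma_positive_iff[OF _ sym]] by blast
  qed
  ultimately show ?thesis using assms(3) by simp
qed

end
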